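(* There exists a Banach space $X$ with a normalised basis $(e_j)_{j=1}^\infty$ satisfying $$\left\|\sum_{j=1}^\infty \lambda_j a_j e_j\right\|\le \left\|\sum_{j=1}^\infty a_j e_j\right\|$$ for every $\sum_{j=1}^\infty a_j e_j\in X$ and all scalars $(\lambda_j)$ with $|\lambda_j|\le 1$ for all $j$, such that the left democracy function $h_l$ of this basis is not doubling.
   Context: Normalised means $\|e_j\|=1$ for all $j$. The left democracy function of a basis $(e_j)_{j=1}^\infty$ of a Banach space is $$h_l(N)=\inf\left\{\left\|\sum_{j\in\Lambda}e_j\right\| : \Lambda\subset\{1,2,\dots\},\ \#\Lambda=N\right\},\qquad N=1,2,\dots$$ A positive function $\phi(n)$ defined for $n=1,2,\dots$ is called doubling if there exists a constant $C$ such that $\phi(2n)\le C\phi(n)$ for all $n$. *)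

theory Defs
  imports "HOL-Analysis.Analysis" "HOL-Library.Function_Algebras"
begin

text \<open>
  A Banach space is given by a carrier \<open>X\<close>, a linear subspace of an ambient vector space over
  \<open>'k\<close>, and a norm whose values matter only on \<open>X\<close>; this allows quantification over Banach
  spaces. The scalar field \<open>'k\<close> stands for the reals or the complex numbers.
\<close>

locale normed_space_on = vector_space scale
  for scale :: "'k::{real_normed_field, banach} \<Rightarrow> 'v::ab_group_add \<Rightarrow> 'v" +
  fixes X :: "'v set" and nrm :: "'v \<Rightarrow> real"
  assumes subspace_X: "module.subspace scale X"
    and nrm_nonneg: "x \<in> X \<Longrightarrow> 0 \<le> nrm x"
    and nrm_eq_0_iff: "x \<in> X \<Longrightarrow> nrm x = 0 \<longleftrightarrow> x = 0"
    and nrm_scale: "x \<in> X \<Longrightarrow> nrm (scale c x) = norm c * nrm x"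
    and nrm_triangle: "x \<in> X \<Longrightarrow> y \<in> X \<Longrightarrow> nrm (x + y) \<le> nrm x + nrm y"
begin

text \<open>The value \<open>0\<close> off the carrier is there because \<^locale>\<open>Metric_space\<close> requires nonnegativity
  and symmetry on the whole type.\<close>

definition nrm_dist :: "'v \<Rightarrow> 'v \<Rightarrow> real" where
  "nrm_dist x y = (if x \<in> X \<and> y \<in> X then nrm (x - y) else 0)"

sublocale met: Metric_space X nrm_dist
proof
  have diff: "x - y \<in> X" if "x \<in> X" "y \<in> X" for x y
    using that subspace_X subspace_diff by blast
  show "0 \<le> nrm_dist x y" for x y
    by (simp add: nrm_dist_def diff nrm_nonneg)
  show "nrm_dist x y = nrm_dist y x" for x y
  proof (cases "x \<in> X \<and> y \<in> X")
    case True
    have "nrm (x - y) = nrm (scale (- 1) (y - x))"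
      by (simp add: scale_minus_left)
    also have "\<dots> = nrm (y - x)"
      using True by (simp only: nrm_scale diff) simp
    finally show ?thesis
      using True by (simp add: nrm_dist_def)
  qed (auto simp: nrm_dist_def)
  show "nrm_dist x y = 0 \<longleftrightarrow> x = y" if "x \<in> X" "y \<in> X" for x y
    using that by (simp add: nrm_dist_def nrm_eq_0_iff diff)
  show "nrm_dist x z \<le> nrm_dist x y + nrm_dist y z" if "x \<in> X" "y \<in> X" "z \<in> X" for x y z
    using nrm_triangle[of "x - y" "y - z"] that by (simp add: nrm_dist_def diff)
qed

text \<open>The series \<open>\<Sum>\<^sub>j a\<^sub>j e\<^sub>j\<close> converges in norm to \<open>x\<close>; this entails \<open>x \<in> X\<close>.\<close>

definition series_sums :: "(nat \<Rightarrow> 'v) \<Rightarrow> (nat \<Rightarrow> 'k) \<Rightarrow> 'v \<Rightarrow> bool" where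
  "series_sums e a x \<longleftrightarrow>
     limitin met.mtopology (\<lambda>n. \<Sum>j<n. scale (a j) (e j)) x sequentially"

definition schauder_basis :: "(nat \<Rightarrow> 'v) \<Rightarrow> bool" where
  "schauder_basis e \<longleftrightarrow> range e \<subseteq> X \<and> (\<forall>x\<in>X. \<exists>!a. series_sums e a x)"

end

locale banach_space_on = normed_space_on +
  assumes complete_X: "met.mcomplete"

definition left_democracy :: "('v::comm_monoid_add \<Rightarrow> real) \<Rightarrow> (nat \<Rightarrow> 'v) \<Rightarrow> nat \<Rightarrow> real" where
  "left_democracy nrm e N = Inf {nrm (\<Sum>j\<in>\<Lambda>. e j) |\<Lambda>. finite \<Lambda> \<and> card \<Lambda> = N}"

definition doubling :: "(nat \<Rightarrow> real) \<Rightarrow> bool" where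
  "doubling \<phi> \<longleftrightarrow> (\<exists>C. \<forall>n\<ge>1. \<phi> (2 * n) \<le> C * \<phi> n)"

end

theory Submission
  imports Defs
begin

text \<open>
  The space is the combinatorial Banach space of a family \<open>F\<close> of finite sets of indices:
  \<open>\<parallel>x\<parallel> = sup\<^sub>A\<^sub>\<in>\<^sub>F \<Sum>\<^sub>j\<^sub>\<in>\<^sub>A |x\<^sub>j|\<close>. As soon as \<open>F\<close> contains the singletons and is closed
  under subsets, the unit sequences form a normalised basis of it. The norm depends only on the
  moduli \<open>|x\<^sub>j|\<close> and increases with them, which is the required unconditionality with constant 1.
  Moreover \<open>\<parallel>\<Sum>\<^sub>j\<^sub>\<in>\<^sub>\<Lambda> e\<^sub>j\<parallel>\<close> is simply the largest size of a member of \<open>F\<close> inside \<open>\<Lambda>\<close>,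
  so that the left democracy function is a purely combinatorial quantity.

  If \<open>h\<^sub>l\<close> jumps between \<open>N\<close> and \<open>2N\<close>, no two disjoint sets of size \<open>N\<close> can both have small norm,
  since their union has norm at most the sum of the two. The way to achieve this is to have the
  sets of small norm fill most of an initial segment of the indices, which suggests the choice
  of \<open>F\<close>: cut the indices into the blocks \<open>{k!, \<dots>, (k+1)! - 1}\<close> and let \<open>F\<close> consist of
  the finite sets with at most \<open>k!\<close> elements in the \<open>k\<close>-th block (so the space is an
  \<open>\<ell>\<^sub>1\<close>-sum of finite-dimensional spaces, the \<open>k\<close>-th with the sum of the \<open>k!\<close> largest moduli as
  its norm). Take \<open>N = (k+1)!\<close>. The first \<open>N\<close> indices contain members of \<open>F\<close> of size at most
  \<open>1 + 1! + \<dots> + k! \<le> 2 k!\<close> only (\<open>card_factorial_family_le\<close>), hence \<open>h\<^sub>l(N) \<le> 2 k!\<close>. On the other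
  hand, a set of \<open>2N\<close> indices has at least \<open>N\<close> elements beyond that segment, where
  every block admits \<open>N\<close> elements; so it contains a member of \<open>F\<close> of size \<open>N\<close>
  (\<open>factorial_familyI\<close>), and \<open>h\<^sub>l(2N) \<ge> N = (k+1)!\<close>. The quotient is at least \<open>(k+1)/2\<close>.
\<close>

section \<open>Coordinatewise scaling and unit sequences\<close>

definition coord_scale :: "'k::times \<Rightarrow> (nat \<Rightarrow> 'k) \<Rightarrow> nat \<Rightarrow> 'k" where
  "coord_scale c x = (\<lambda>j. c * x j)"

definition unit_seq :: "nat \<Rightarrow> nat \<Rightarrow> 'k::zero_neq_one" where
  "unit_seq j = (\<lambda>i. of_bool (i = j))"

lemma vector_space_coord_scale: "vector_space (coord_scale :: 'k::field \<Rightarrow> _)"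
  by unfold_locales (auto simp: coord_scale_def algebra_simps)

lemma sum_fun_apply: "(\<Sum>i\<in>A. f i) j = (\<Sum>i\<in>A. f i j)"
  by (induction A rule: infinite_finite_induct) auto

lemma sum_coord_scale_unit_seq:
  fixes a :: "nat \<Rightarrow> 'k::field"
  assumes "finite A"
  shows "(\<Sum>j\<in>A. coord_scale (a j) (unit_seq j)) = (\<lambda>i. if i \<in> A then a i else 0)"
  using assms
  by (auto simp: sum_fun_apply coord_scale_def unit_seq_def of_bool_def if_distrib cong: if_cong)

lemma sum_unit_seq:
  assumes "finite A"
  shows "(\<Sum>j\<in>A. unit_seq j) = (\<lambda>i. of_bool (i \<in> A) :: 'k::field)"
  using assms by (auto simp: sum_fun_apply unit_seq_def of_bool_def)

section \<open>The combinatorial Banach space of a family of finite sets\<close>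

locale combinatorial_family =
  fixes F :: "nat set set"
  assumes finite_mem: "A \<in> F \<Longrightarrow> finite A"
    and singleton_mem: "{j} \<in> F"
    and subset_mem: "A \<in> F \<Longrightarrow> B \<subseteq> A \<Longrightarrow> B \<in> F"
begin

text \<open>
  Boundedness of the sums over members of \<open>F\<close> would make a Banach space too, but one in which the
  unit sequences need not have dense span; uniformly small tails single out the closure of the
  finitely supported sequences. They also imply boundedness, so that \<open>comb_norm\<close> below
  is a supremum of a bounded set on this space.
\<close>

definition comb_space :: "(nat \<Rightarrow> 'k::real_normed_field) set" where
  "comb_space = {x. \<forall>\<epsilon>>0. \<exists>n. \<forall>A\<in>F. A \<subseteq> {n..} \<longrightarrow> (\<Sum>j\<in>A. norm (x j)) \<le> \<epsilon>}"

definition comb_norm :: "(nat \<Rightarrow> 'k::real_normed_field) \<Rightarrow> real" where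
  "comb_norm x = (SUP A\<in>F. \<Sum>j\<in>A. norm (x j))"

lemma sum_split_at:
  assumes "A \<in> F"
  shows "(\<Sum>j\<in>A. f j) = (\<Sum>j\<in>A \<inter> {..<n}. f j) + (\<Sum>j\<in>A \<inter> {n..}. f j :: real)"
proof -
  have "A = (A \<inter> {..<n}) \<union> (A \<inter> {n..})" by auto
  then show ?thesis
    using sum.union_disjoint[of "A \<inter> {..<n}" "A \<inter> {n..}" f] finite_mem[OF assms]
    by fastforce
qed

lemma comb_space_tail:
  assumes "x \<in> comb_space" "\<epsilon> > 0"
  obtains n where "\<And>A. A \<in> F \<Longrightarrow> A \<subseteq> {n..} \<Longrightarrow> (\<Sum>j\<in>A. norm (x j)) \<le> \<epsilon>"
proof -
  have "\<exists>n. \<forall>A\<in>F. A \<subseteq> {n..} \<longrightarrow> (\<Sum>j\<in>A. norm (x j)) \<le> \<epsilon>"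
    using assms unfolding comb_space_def by simp
  then show ?thesis using that by blast
qed

lemma comb_norm_le:
  assumes "\<And>A. A \<in> F \<Longrightarrow> (\<Sum>j\<in>A. norm (x j)) \<le> c"
  shows "comb_norm x \<le> c"
  unfolding comb_norm_def using assms singleton_mem by (intro cSUP_least) auto

lemma sum_le_comb_norm:
  assumes x: "x \<in> comb_space" and A: "A \<in> F"
  shows "(\<Sum>j\<in>A. norm (x j)) \<le> comb_norm x"
proof -
  obtain n where n: "\<And>A. A \<in> F \<Longrightarrow> A \<subseteq> {n..} \<Longrightarrow> (\<Sum>j\<in>A. norm (x j)) \<le> 1"
    using comb_space_tail[OF x zero_less_one] by blast
  have "(\<Sum>j\<in>A. norm (x j)) \<le> (\<Sum>j<n. norm (x j)) + 1" if "A \<in> F" for A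
    unfolding sum_split_at[OF that, of _ n]
    using n[OF subset_mem[OF that]] by (intro add_mono sum_mono2) auto
  then have "bdd_above ((\<lambda>A. \<Sum>j\<in>A. norm (x j)) ` F)" by (intro bdd_aboveI2)
  then show ?thesis unfolding comb_norm_def using A by (rule cSUP_upper2) auto
qed

lemma norm_coord_le: "x \<in> comb_space \<Longrightarrow> norm (x j) \<le> comb_norm x"
  using sum_le_comb_norm[OF _ singleton_mem] by fastforce

text \<open>The form of closedness that applies before a limit is known to belong to the space.\<close>

lemma comb_spaceI_approx:
  assumes "\<And>\<epsilon>. \<epsilon> > 0 \<Longrightarrow> \<exists>y\<in>comb_space. \<forall>A\<in>F. (\<Sum>j\<in>A. norm (x j - y j)) \<le> \<epsilon>"
  shows "x \<in> comb_space"
  unfolding comb_space_def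
proof (intro CollectI allI impI)
  fix \<epsilon> :: real assume "\<epsilon> > 0"
  then obtain y where y: "y \<in> comb_space" "\<And>A. A \<in> F \<Longrightarrow> (\<Sum>j\<in>A. norm (x j - y j)) \<le> \<epsilon> / 2"
    using assms[of "\<epsilon> / 2"] by auto
  have "\<epsilon> / 2 > 0" using \<open>\<epsilon> > 0\<close> by simp
  then obtain n where n: "\<And>A. A \<in> F \<Longrightarrow> A \<subseteq> {n..} \<Longrightarrow> (\<Sum>j\<in>A. norm (y j)) \<le> \<epsilon> / 2"
    using comb_space_tail[OF y(1)] by blast
  have "(\<Sum>j\<in>A. norm (x j)) \<le> \<epsilon>" if A: "A \<in> F" "A \<subseteq> {n..}" for A
  proof -
    have "(\<Sum>j\<in>A. norm (x j)) \<le> (\<Sum>j\<in>A. norm (x j - y j) + norm (y j))"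
      by (intro sum_mono) (use norm_triangle_sub in \<open>simp add: add.commute\<close>)
    then show ?thesis using y(2)[OF A(1)] n[OF A] by (simp add: sum.distrib)
  qed
  then show "\<exists>n. \<forall>A\<in>F. A \<subseteq> {n..} \<longrightarrow> (\<Sum>j\<in>A. norm (x j)) \<le> \<epsilon>" by blast
qed

text \<open>Solidity of the norm is what makes the basis unconditional with constant 1.\<close>

lemma comb_space_solid:
  assumes x: "x \<in> comb_space" and le: "\<And>j. norm (y j) \<le> norm (x j)"
  shows "y \<in> comb_space" and "comb_norm y \<le> comb_norm x"
proof -
  have *: "(\<Sum>j\<in>A. norm (y j)) \<le> (\<Sum>j\<in>A. norm (x j))" for A
    by (intro sum_mono le)
  show "y \<in> comb_space"
    unfolding comb_space_def
  proof (intro CollectI allI impI)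
    fix \<epsilon> :: real assume "\<epsilon> > 0"
    then obtain n where "\<forall>A\<in>F. A \<subseteq> {n..} \<longrightarrow> (\<Sum>j\<in>A. norm (x j)) \<le> \<epsilon>"
      using comb_space_tail[OF x] by metis
    then show "\<exists>n. \<forall>A\<in>F. A \<subseteq> {n..} \<longrightarrow> (\<Sum>j\<in>A. norm (y j)) \<le> \<epsilon>"
      using * order_trans by (intro exI[of _ n]) blast
  qed
  show "comb_norm y \<le> comb_norm x"
    by (intro comb_norm_le order_trans[OF * sum_le_comb_norm[OF x]])
qed

lemma finite_support_mem:
  assumes "\<And>j. j \<ge> n \<Longrightarrow> x j = 0"
  shows "x \<in> comb_space"
proof -
  have "(\<Sum>j\<in>A. norm (x j)) = 0" if "A \<subseteq> {n..}" for A
    using assms that by (intro sum.neutral) auto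
  then have "\<forall>A\<in>F. A \<subseteq> {n..} \<longrightarrow> (\<Sum>j\<in>A. norm (x j)) \<le> \<epsilon>" if "\<epsilon> > 0" for \<epsilon>
    using that by simp
  then show ?thesis unfolding comb_space_def by blast
qed

lemma zero_mem: "0 \<in> comb_space"
  by (rule finite_support_mem[of 0]) simp

lemma add_mem:
  assumes "x \<in> comb_space" "y \<in> comb_space"
  shows "x + y \<in> comb_space"
  unfolding comb_space_def
proof (intro CollectI allI impI)
  fix \<epsilon> :: real assume "\<epsilon> > 0"
  then have "\<epsilon> / 2 > 0" by simp
  obtain n where
    n: "\<And>A. A \<in> F \<Longrightarrow> A \<subseteq> {n..} \<Longrightarrow> (\<Sum>j\<in>A. norm (x j)) \<le> \<epsilon> / 2"
    using comb_space_tail[OF assms(1) \<open>\<epsilon> / 2 > 0\<close>] by blast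
  obtain m where
    m: "\<And>A. A \<in> F \<Longrightarrow> A \<subseteq> {m..} \<Longrightarrow> (\<Sum>j\<in>A. norm (y j)) \<le> \<epsilon> / 2"
    using comb_space_tail[OF assms(2) \<open>\<epsilon> / 2 > 0\<close>] by blast
  have "(\<Sum>j\<in>A. norm ((x + y) j)) \<le> \<epsilon>" if A: "A \<in> F" "A \<subseteq> {max n m..}" for A
  proof -
    have "(\<Sum>j\<in>A. norm ((x + y) j)) \<le> (\<Sum>j\<in>A. norm (x j) + norm (y j))"
      by (intro sum_mono) (simp add: norm_triangle_ineq)
    moreover have "A \<subseteq> {n..}" "A \<subseteq> {m..}" using A(2) by auto
    ultimately show ?thesis using n[OF A(1)] m[OF A(1)] by (simp add: sum.distrib)
  qed
  then show "\<exists>n. \<forall>A\<in>F. A \<subseteq> {n..} \<longrightarrow> (\<Sum>j\<in>A. norm ((x + y) j)) \<le> \<epsilon>" by blast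
qed

lemma scale_mem:
  assumes "x \<in> comb_space"
  shows "coord_scale c x \<in> comb_space"
  unfolding comb_space_def
proof (intro CollectI allI impI)
  fix \<epsilon> :: real assume "\<epsilon> > 0"
  then have "\<epsilon> / (norm c + 1) > 0" by (simp add: add_nonneg_pos)
  then obtain n where
    n: "\<And>A. A \<in> F \<Longrightarrow> A \<subseteq> {n..} \<Longrightarrow> (\<Sum>j\<in>A. norm (x j)) \<le> \<epsilon> / (norm c + 1)"
    using comb_space_tail[OF assms] by blast
  have "(\<Sum>j\<in>A. norm (coord_scale c x j)) \<le> \<epsilon>" if A: "A \<in> F" "A \<subseteq> {n..}" for A
  proof -
    have "(\<Sum>j\<in>A. norm (coord_scale c x j)) = norm c * (\<Sum>j\<in>A. norm (x j))"
      by (simp add: coord_scale_def norm_mult sum_distrib_left)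
    also have "\<dots> \<le> (norm c + 1) * (\<epsilon> / (norm c + 1))"
      using n[OF A] by (intro mult_mono) (auto intro: sum_nonneg)
    also have "\<dots> = \<epsilon>" using norm_ge_zero[of c] by (simp add: add_nonneg_eq_0_iff)
    finally show ?thesis .
  qed
  then show "\<exists>n. \<forall>A\<in>F. A \<subseteq> {n..} \<longrightarrow> (\<Sum>j\<in>A. norm (coord_scale c x j)) \<le> \<epsilon>" by blast
qed

lemma comb_norm_scale:
  assumes x: "x \<in> comb_space"
  shows "comb_norm (coord_scale c x) = norm c * comb_norm x"
proof (rule antisym)
  have eq: "(\<Sum>j\<in>A. norm (coord_scale c x j)) = norm c * (\<Sum>j\<in>A. norm (x j))" for A
    by (simp add: coord_scale_def norm_mult sum_distrib_left)
  show "comb_norm (coord_scale c x) \<le> norm c * comb_norm x"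
    using sum_le_comb_norm[OF x] by (intro comb_norm_le) (simp add: eq mult_left_mono)
  show "norm c * comb_norm x \<le> comb_norm (coord_scale c x)"
  proof (cases "c = 0")
    case True
    then show ?thesis
      using norm_coord_le[OF scale_mem[OF x], of c 0] by (simp add: coord_scale_def)
  next
    case False
    have "comb_norm x \<le> comb_norm (coord_scale c x) / norm c"
      using sum_le_comb_norm[OF scale_mem[OF x], of _ c] False
      by (intro comb_norm_le) (simp add: eq pos_le_divide_eq mult.commute)
    then show ?thesis using False by (simp add: pos_le_divide_eq mult.commute)
  qed
qed

lemma comb_norm_triangle:
  assumes "x \<in> comb_space" "y \<in> comb_space"
  shows "comb_norm (x + y) \<le> comb_norm x + comb_norm y"
proof (rule comb_norm_le)
  fix A assume A: "A \<in> F"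
  have "(\<Sum>j\<in>A. norm ((x + y) j)) \<le> (\<Sum>j\<in>A. norm (x j) + norm (y j))"
    by (intro sum_mono) (simp add: norm_triangle_ineq)
  also have "\<dots> \<le> comb_norm x + comb_norm y"
    using assms A by (simp add: sum.distrib add_mono sum_le_comb_norm)
  finally show "(\<Sum>j\<in>A. norm ((x + y) j)) \<le> comb_norm x + comb_norm y" .
qed

lemma comb_norm_zero: "comb_norm (0 :: nat \<Rightarrow> 'k::real_normed_field) = 0"
  using comb_norm_le[of "0 :: nat \<Rightarrow> 'k" 0]
    norm_coord_le[of "0 :: nat \<Rightarrow> 'k" 0, OF zero_mem] by simp

lemma normed_space_comb:
  "normed_space_on coord_scale (comb_space :: (nat \<Rightarrow> 'k::{real_normed_field,banach}) set) comb_norm"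
proof -
  interpret vector_space "coord_scale :: 'k \<Rightarrow> _" by (rule vector_space_coord_scale)
  show ?thesis
  proof
    show "subspace (comb_space :: (nat \<Rightarrow> 'k) set)"
      by (rule subspaceI) (auto simp: zero_mem add_mem scale_mem)
  next
    fix x :: "nat \<Rightarrow> 'k" assume x: "x \<in> comb_space"
    show "0 \<le> comb_norm x" by (rule order_trans[OF norm_ge_zero norm_coord_le[OF x, of 0]])
    have "x = 0" if "comb_norm x = 0"
      using norm_coord_le[OF x] that by (auto simp: fun_eq_iff)
    then show "comb_norm x = 0 \<longleftrightarrow> x = 0" by (auto simp: comb_norm_zero)
  qed (auto simp: comb_norm_scale comb_norm_triangle)
qed

lemma diff_mem:
  fixes x :: "nat \<Rightarrow> 'k::{real_normed_field,banach}"
  assumes "x \<in> comb_space" "y \<in> comb_space"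
  shows "x - y \<in> comb_space"
proof -
  interpret normed_space_on coord_scale "comb_space :: (nat \<Rightarrow> 'k) set" comb_norm
    by (rule normed_space_comb)
  show ?thesis using assms subspace_X subspace_diff by blast
qed

text \<open>
  The norm dominates every coordinate, so a Cauchy sequence converges coordinatewise. The Cauchy
  estimate over a fixed \<open>A \<in> F\<close> is a finite sum and survives the passage to the coordinatewise
  limit, with a bound independent of \<open>A\<close>.
\<close>

lemma banach_space_comb:
  "banach_space_on coord_scale (comb_space :: (nat \<Rightarrow> 'k::{real_normed_field,banach}) set) comb_norm"
proof -
  interpret normed_space_on coord_scale "comb_space :: (nat \<Rightarrow> 'k) set" comb_norm
    by (rule normed_space_comb)
  show ?thesis
  proof
    show "met.mcomplete" unfolding met.mcomplete_def
    proof (intro allI impI)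
      fix s :: "nat \<Rightarrow> nat \<Rightarrow> 'k" assume C: "met.MCauchy s"
      then have s: "s n \<in> comb_space" for n unfolding met.MCauchy_def by auto
      have cau: "\<exists>N. \<forall>n\<ge>N. \<forall>m\<ge>N. comb_norm (s n - s m) < \<epsilon>" if "\<epsilon> > 0" for \<epsilon>
        using C that unfolding met.MCauchy_def nrm_dist_def by (auto simp: s)
      have "Cauchy (\<lambda>n. s n j)" for j
      proof (rule metric_CauchyI)
        fix \<epsilon> :: real assume "\<epsilon> > 0"
        then obtain N where "\<forall>n\<ge>N. \<forall>m\<ge>N. comb_norm (s n - s m) < \<epsilon>" using cau by blast
        moreover have "dist (s n j) (s m j) \<le> comb_norm (s n - s m)" for n m
          using norm_coord_le[OF diff_mem[OF s s]] by (auto simp: dist_norm)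
        ultimately have "dist (s m j) (s n j) < \<epsilon>" if "m \<ge> N" "n \<ge> N" for m n
          using that le_less_trans by blast
        then show "\<exists>N. \<forall>m\<ge>N. \<forall>n\<ge>N. dist (s m j) (s n j) < \<epsilon>" by blast
      qed
      then have "\<exists>l. (\<lambda>n. s n j) \<longlonglongrightarrow> l" for j
        using Cauchy_convergent convergent_def by blast
      then obtain y where y: "\<And>j. (\<lambda>n. s n j) \<longlonglongrightarrow> y j" by metis
      have close: "\<exists>N. \<forall>n\<ge>N. \<forall>A\<in>F. (\<Sum>j\<in>A. norm (y j - s n j)) \<le> \<epsilon>" if "\<epsilon> > 0" for \<epsilon>
      proof -
        obtain N where N: "\<forall>n\<ge>N. \<forall>m\<ge>N. comb_norm (s n - s m) < \<epsilon>" using cau[OF \<open>\<epsilon> > 0\<close>] by blast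
        have "(\<Sum>j\<in>A. norm (y j - s n j)) \<le> \<epsilon>" if nA: "n \<ge> N" "A \<in> F" for n A
        proof (rule LIMSEQ_le_const2)
          show "(\<lambda>m. \<Sum>j\<in>A. norm (s m j - s n j)) \<longlonglongrightarrow> (\<Sum>j\<in>A. norm (y j - s n j))"
            by (intro tendsto_intros y)
          show "\<exists>M. \<forall>m\<ge>M. (\<Sum>j\<in>A. norm (s m j - s n j)) \<le> \<epsilon>"
          proof (intro exI[of _ N] allI impI)
            fix m assume "m \<ge> N"
            then have "comb_norm (s m - s n) \<le> \<epsilon>" using N nA(1) by (simp add: less_imp_le)
            then show "(\<Sum>j\<in>A. norm (s m j - s n j)) \<le> \<epsilon>"
              using sum_le_comb_norm[OF diff_mem[OF s[of m] s[of n]] nA(2)] by simp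
          qed
        qed
        then show ?thesis by blast
      qed
      have ymem: "y \<in> comb_space"
      proof (rule comb_spaceI_approx)
        fix \<epsilon> :: real assume "\<epsilon> > 0"
        then obtain N where "\<forall>n\<ge>N. \<forall>A\<in>F. (\<Sum>j\<in>A. norm (y j - s n j)) \<le> \<epsilon>"
          using close by blast
        then show "\<exists>z\<in>comb_space. \<forall>A\<in>F. (\<Sum>j\<in>A. norm (y j - z j)) \<le> \<epsilon>"
          using s[of N] by (intro bexI[of _ "s N"]) auto
      qed
      have "\<exists>N. \<forall>n\<ge>N. comb_norm (s n - y) < \<epsilon>" if "\<epsilon> > 0" for \<epsilon>
      proof -
        obtain N where N: "\<And>n A. n \<ge> N \<Longrightarrow> A \<in> F \<Longrightarrow> (\<Sum>j\<in>A. norm (y j - s n j)) \<le> \<epsilon> / 2"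
          using close[of "\<epsilon> / 2"] \<open>\<epsilon> > 0\<close> by auto
        have "comb_norm (s n - y) \<le> \<epsilon> / 2" if "n \<ge> N" for n
          using N[OF that] by (intro comb_norm_le) (simp add: norm_minus_commute)
        then show ?thesis using \<open>\<epsilon> > 0\<close> by (intro exI[of _ N]) fastforce
      qed
      then show "\<exists>x. limitin met.mtopology s x sequentially"
        unfolding met.limitin_metric eventually_sequentially
        by (intro exI[of _ y]) (simp add: ymem s nrm_dist_def)
    qed
  qed
qed

section \<open>The unit sequences as a basis\<close>

text \<open>
  Coordinates are continuous, which determines the coefficients; the error of a partial sum of
  \<open>\<Sum>\<^sub>j x\<^sub>j e\<^sub>j\<close> is a tail of \<open>x\<close>, and the tails tend to 0 by the definition of the space. The basis
  property and the unconditionality are both read off from this equivalence.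
\<close>

lemma series_sums_unit_seq_iff:
  fixes a x :: "nat \<Rightarrow> 'k::{real_normed_field,banach}"
  shows "normed_space_on.series_sums coord_scale comb_space comb_norm unit_seq a x
    \<longleftrightarrow> a = x \<and> x \<in> comb_space"
proof -
  interpret normed_space_on coord_scale "comb_space :: (nat \<Rightarrow> 'k) set" comb_norm
    by (rule normed_space_comb)
  define p where "p n = (\<lambda>i. if i < n then a i else 0)" for n
  have p_mem: "p n \<in> comb_space" for n
    by (rule finite_support_mem[of n]) (simp add: p_def)
  have sums_iff: "series_sums unit_seq a x \<longleftrightarrow>
      x \<in> comb_space \<and> (\<forall>\<epsilon>>0. \<exists>N. \<forall>n\<ge>N. x \<in> comb_space \<longrightarrow> comb_norm (p n - x) < \<epsilon>)"
    by (auto simp: series_sums_def met.limitin_metric eventually_sequentially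
        sum_coord_scale_unit_seq p_mem nrm_dist_def simp flip: p_def)
  show ?thesis
  proof
    assume sums: "series_sums unit_seq a x"
    then have x: "x \<in> comb_space" by (simp add: sums_iff)
    have "a j = x j" for j
    proof (rule ccontr)
      assume "a j \<noteq> x j"
      then have "norm (a j - x j) > 0" by simp
      then obtain N where N: "\<And>n. n \<ge> N \<Longrightarrow> comb_norm (p n - x) < norm (a j - x j)"
        using sums unfolding sums_iff by blast
      have "norm (a j - x j) = norm ((p (max N (Suc j)) - x) j)"
        by (simp add: p_def less_max_iff_disj)
      also have "\<dots> \<le> comb_norm (p (max N (Suc j)) - x)"
        by (rule norm_coord_le[OF diff_mem[OF p_mem x]])
      also have "\<dots> < norm (a j - x j)" by (rule N) simp
      finally show False by simp
    qed
    then show "a = x \<and> x \<in> comb_space" using x by auto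
  next
    assume ax: "a = x \<and> x \<in> comb_space"
    have "\<exists>N. \<forall>n\<ge>N. comb_norm (p n - x) < \<epsilon>" if "\<epsilon> > 0" for \<epsilon>
    proof -
      have "\<epsilon> / 2 > 0" using that by simp
      then obtain N where N: "\<And>A. A \<in> F \<Longrightarrow> A \<subseteq> {N..} \<Longrightarrow> (\<Sum>j\<in>A. norm (x j)) \<le> \<epsilon> / 2"
        using ax comb_space_tail by blast
      have "comb_norm (p n - x) \<le> \<epsilon> / 2" if "n \<ge> N" for n
      proof (rule comb_norm_le)
        fix A assume A: "A \<in> F"
        have "(\<Sum>j\<in>A. norm ((p n - x) j)) = (\<Sum>j\<in>A \<inter> {n..}. norm (x j))"
          unfolding sum_split_at[OF A, of _ n] using ax by (simp add: p_def)
        also have "\<dots> \<le> \<epsilon> / 2" using that by (intro N subset_mem[OF A]) auto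
        finally show "(\<Sum>j\<in>A. norm ((p n - x) j)) \<le> \<epsilon> / 2" .
      qed
      then show ?thesis using that by (intro exI[of _ N]) fastforce
    qed
    then show "series_sums unit_seq a x" unfolding sums_iff using ax by blast
  qed
qed

lemma unit_seq_mem: "unit_seq j \<in> comb_space"
  by (rule finite_support_mem[of "Suc j"]) (simp add: unit_seq_def)

lemma schauder_basis_unit_seq:
  "normed_space_on.schauder_basis coord_scale
     (comb_space :: (nat \<Rightarrow> 'k::{real_normed_field,banach}) set) comb_norm unit_seq"
proof -
  interpret normed_space_on coord_scale "comb_space :: (nat \<Rightarrow> 'k) set" comb_norm
    by (rule normed_space_comb)
  show ?thesis
    unfolding schauder_basis_def by (auto simp: series_sums_unit_seq_iff unit_seq_mem)
qed

text \<open>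
  Together with the next lemma: the norm of the indicator of \<open>L\<close> is the maximal size of
  a member of the family inside \<open>L\<close>.
\<close>

lemma comb_norm_indicator_le:
  assumes "finite L" "\<And>A. A \<in> F \<Longrightarrow> A \<subseteq> L \<Longrightarrow> card A \<le> m"
  shows "comb_norm (\<Sum>j\<in>L. unit_seq j :: nat \<Rightarrow> 'k::real_normed_field) \<le> real m"
proof (rule comb_norm_le)
  fix A assume A: "A \<in> F"
  have "(\<Sum>i\<in>A. norm ((\<Sum>j\<in>L. unit_seq j :: nat \<Rightarrow> 'k) i)) = card (A \<inter> L)"
    using finite_mem[OF A]
    by (simp add: sum_unit_seq[OF assms(1)] of_bool_def if_distrib sum.If_cases Int_def
        cong: if_cong)
  then show "(\<Sum>i\<in>A. norm ((\<Sum>j\<in>L. unit_seq j :: nat \<Rightarrow> 'k) i)) \<le> real m"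
    using assms(2)[OF subset_mem[OF A]] by simp
qed

lemma card_le_comb_norm_indicator:
  assumes "finite L" "A \<in> F" "A \<subseteq> L"
  shows "real (card A) \<le> comb_norm (\<Sum>j\<in>L. unit_seq j :: nat \<Rightarrow> 'k::real_normed_field)"
proof -
  have "(\<Sum>j\<in>L. unit_seq j :: nat \<Rightarrow> 'k) \<in> comb_space"
    using assms(1) by (intro finite_support_mem[of "Suc (Max L)"])
      (auto simp: sum_unit_seq of_bool_def dest: Max_ge)
  from sum_le_comb_norm[OF this assms(2)]
  show ?thesis using assms(3)
    by (simp add: sum_unit_seq[OF assms(1)] of_bool_def subset_iff cong: sum.cong)
qed

lemma comb_norm_unit_seq: "comb_norm (unit_seq j :: nat \<Rightarrow> 'k::real_normed_field) = 1"
proof (rule antisym)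
  show "comb_norm (unit_seq j :: nat \<Rightarrow> 'k) \<le> 1"
    using comb_norm_indicator_le[of "{j}" 1, where 'k = 'k]
      card_mono[of "{j}"] by simp
  show "1 \<le> comb_norm (unit_seq j :: nat \<Rightarrow> 'k)"
    using card_le_comb_norm_indicator[of "{j}" "{j}", where 'k = 'k] singleton_mem by simp
qed

end

section \<open>A family built from factorial blocks\<close>

text \<open>
  The quota \<open>k!\<close> of a block is the number of indices before it, and it is large compared
  with the sum of all earlier quotas because factorials grow faster than geometrically.
  The index 0 lies in no block, and the block
  of \<open>k = 0\<close> is empty.
\<close>

definition factorial_family :: "nat set set" where
  "factorial_family = {A. finite A \<and> (\<forall>k. card (A \<inter> {fact k..<fact (Suc k)}) \<le> fact k)}"

interpretation fac: combinatorial_family factorial_family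
proof
  have "card ({j} \<inter> S) \<le> fact k" for j :: nat and S k
    using order_trans[OF card_mono[of "{j}" "{j} \<inter> S"], of "fact k"] fact_ge_1[of k] by simp
  then show "{j} \<in> factorial_family" for j
    unfolding factorial_family_def by blast
  fix A B :: "nat set"
  assume A: "A \<in> factorial_family" and "B \<subseteq> A"
  then have "finite A" "finite B" by (auto simp: factorial_family_def finite_subset)
  have "card (B \<inter> {fact k..<fact (Suc k)}) \<le> fact k" for k
  proof -
    have "card (B \<inter> {fact k..<fact (Suc k)}) \<le> card (A \<inter> {fact k..<fact (Suc k)})"
      using \<open>finite A\<close> \<open>B \<subseteq> A\<close> by (intro card_mono) auto
    also have "\<dots> \<le> fact k" using A unfolding factorial_family_def by blast
    finally show ?thesis .
  qed
  then show "B \<in> factorial_family"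
    unfolding factorial_family_def using \<open>finite B\<close> by blast
qed (simp add: factorial_family_def)

text \<open>The bound is \<open>1 + 1! + \<dots> + k! \<le> 2 k!\<close>: for \<open>k \<ge> 1\<close>, the last summand
  is at least the sum of the others.\<close>

lemma card_factorial_family_le:
  assumes A: "A \<in> factorial_family"
  shows "card (A \<inter> {..<fact (Suc k)}) \<le> 2 * fact k"
proof (induction k)
  case 0
  have "card (A \<inter> {..<1}) \<le> card {..<1::nat}" by (intro card_mono) auto
  then show ?case by simp
next
  case (Suc k)
  show ?case
    \<comment> \<open>The step below needs \<open>2 k! \<le> (k+1)!\<close>, that is \<open>k \<ge> 1\<close>; for \<open>k = 0\<close> there are only the two
      indices 0 and 1.\<close>
  proof (cases k)
    case 0
    have "card (A \<inter> {..<2}) \<le> card {..<2::nat}" by (intro card_mono) auto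
    then show ?thesis by (simp add: 0 numeral_2_eq_2)
  next
    case (Suc i)
    have "A \<inter> {..<fact (Suc (Suc k))} \<subseteq>
        (A \<inter> {..<fact (Suc k)}) \<union> (A \<inter> {fact (Suc k)..<fact (Suc (Suc k))})"
      by auto
    then have "card (A \<inter> {..<fact (Suc (Suc k))}) \<le>
        card (A \<inter> {..<fact (Suc k)}) + card (A \<inter> {fact (Suc k)..<fact (Suc (Suc k))})"
      by (intro order_trans[OF card_mono card_Un_le]) auto
    also have "\<dots> \<le> 2 * fact k + fact (Suc k)"
      using A Suc.IH unfolding factorial_family_def by (intro add_mono) blast+
    also have "\<dots> \<le> 2 * fact (Suc k)"
      using Suc by simp
    finally show ?thesis .
  qed
qed

text \<open>Beyond \<open>k!\<close> all quotas are at least \<open>k!\<close>, so sets of that size are unrestricted there.\<close>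

lemma factorial_familyI:
  assumes "finite A" "A \<subseteq> {fact k..}" "card A \<le> fact k"
  shows "A \<in> factorial_family"
  unfolding factorial_family_def
proof (intro CollectI conjI allI)
  fix i
  show "card (A \<inter> {fact i..<fact (Suc i)}) \<le> fact i"
  proof (cases "i < k")
    case True
    then have "fact (Suc i) \<le> (fact k :: nat)" by (intro fact_mono) simp
    then have "A \<inter> {fact i..<fact (Suc i)} = {}" using assms(2) by fastforce
    then show ?thesis by simp
  next
    case False
    have "card (A \<inter> {fact i..<fact (Suc i)}) \<le> card A" using assms(1) by (intro card_mono) auto
    also have "\<dots> \<le> fact k" by fact
    also have "\<dots> \<le> fact i" using False by (intro fact_mono) simp
    finally show ?thesis .
  qed
qed fact

section \<open>The left democracy function\<close>

lemma not_doubling_left_democracy: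
  "\<not> doubling (left_democracy fac.comb_norm (unit_seq :: nat \<Rightarrow> nat \<Rightarrow> 'k::real_normed_field))"
proof
  let ?e = "unit_seq :: nat \<Rightarrow> nat \<Rightarrow> 'k"
  let ?S = "\<lambda>N. {fac.comb_norm (\<Sum>j\<in>\<Lambda>. ?e j) |\<Lambda>. finite \<Lambda> \<and> card \<Lambda> = N}"
  let ?h = "left_democracy fac.comb_norm ?e"
  have nonempty: "?S N \<noteq> {}" for N
    using finite_lessThan[of N] card_lessThan[of N] by blast
  have nonneg: "0 \<le> v" if "v \<in> ?S N" for v N
    using that fac.card_le_comb_norm_indicator[of _ "{}", where 'k = 'k]
      fac.subset_mem[OF fac.singleton_mem, of "{}"] by auto
  have upper: "?h (fact (Suc k)) \<le> 2 * fact k" for k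
  proof -
    have "fac.comb_norm (\<Sum>j<fact (Suc k). ?e j) \<le> real (2 * fact k)"
    proof (rule fac.comb_norm_indicator_le)
      fix A assume A: "A \<in> factorial_family" "A \<subseteq> {..<fact (Suc k)}"
      then show "card A \<le> 2 * fact k"
        using card_factorial_family_le[OF A(1), of k] by (simp only: Int_absorb2)
    qed simp
    moreover have "?h (fact (Suc k)) \<le> fac.comb_norm (\<Sum>j<fact (Suc k). ?e j)"
      unfolding left_democracy_def
    proof (rule cInf_lower)
      show "fac.comb_norm (\<Sum>j<fact (Suc k). ?e j) \<in> ?S (fact (Suc k))"
        by (intro CollectI exI[of _ "{..<fact (Suc k)}"]) simp
      show "bdd_below (?S (fact (Suc k)))" using nonneg by (intro bdd_belowI)
    qed
    ultimately show ?thesis by simp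
  qed
  have lower: "fact (Suc k) \<le> ?h (2 * fact (Suc k))" for k
    unfolding left_democracy_def
  proof (rule cInf_greatest[OF nonempty])
    fix v assume "v \<in> ?S (2 * fact (Suc k))"
    then obtain L where L: "finite L" "card L = 2 * fact (Suc k)"
      and v: "v = fac.comb_norm (\<Sum>j\<in>L. ?e j)" by blast
    have "card L - card {..<fact (Suc k) :: nat} \<le> card (L - {..<fact (Suc k)})"
      by (rule diff_card_le_card_Diff) simp
    then have "fact (Suc k) \<le> card (L - {..<fact (Suc k)})" using L(2) by simp
    then obtain A where A: "A \<subseteq> L - {..<fact (Suc k)}" "card A = fact (Suc k)" "finite A"
      by (rule obtain_subset_with_card_n)
    then have "A \<in> factorial_family"
      by (intro factorial_familyI[of A "Suc k"]) auto
    then have "real (card A) \<le> v"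
      unfolding v using A L by (intro fac.card_le_comb_norm_indicator) auto
    then show "fact (Suc k) \<le> v" by (simp only: A(2) of_nat_fact)
  qed
  assume "doubling ?h"
  then obtain C where C: "\<And>n. n \<ge> 1 \<Longrightarrow> ?h (2 * n) \<le> C * ?h n"
    unfolding doubling_def by blast
  \<comment> \<open>The doubling constant may be any real number; \<open>max C 0\<close> is a nonnegative one, so that
    the upper bound on \<open>h\<^sub>l\<close> can be multiplied by it.\<close>
  obtain k where k: "2 * max C 0 < real k" using reals_Archimedean2 by blast
  have "real (Suc k) * fact k = fact (Suc k)" by simp
  also have "\<dots> \<le> C * ?h (fact (Suc k))"
    by (rule order_trans[OF lower C[OF fact_ge_1]])
  also have "\<dots> \<le> max C 0 * ?h (fact (Suc k))"
  proof (rule mult_right_mono)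
    show "0 \<le> ?h (fact (Suc k))"
      unfolding left_democracy_def by (rule cInf_greatest[OF nonempty nonneg])
  qed simp
  also have "\<dots> \<le> max C 0 * (2 * fact k)"
    by (intro mult_left_mono upper) simp
  finally have "real (Suc k) * fact k \<le> (2 * max C 0) * fact k" by (simp only: mult_ac)
  then have "real (Suc k) \<le> 2 * max C 0" by (simp only: mult_le_cancel_right_pos fact_gt_zero)
  then show False using k by simp
qed

theorem theorem2p1:
  "\<exists>(scale :: 'k::{real_normed_field, banach} \<Rightarrow> (nat \<Rightarrow> 'k) \<Rightarrow> (nat \<Rightarrow> 'k)) X nrm e.
     banach_space_on scale X nrm \<and>
     normed_space_on.schauder_basis scale X nrm e \<and>
     (\<forall>j. nrm (e j) = 1) \<and>
     (\<forall>a x l. normed_space_on.series_sums scale X nrm e a x \<and> (\<forall>j. norm (l j) \<le> 1) \<longrightarrow>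
        (\<exists>y. normed_space_on.series_sums scale X nrm e (\<lambda>j. l j * a j) y \<and> nrm y \<le> nrm x)) \<and>
     \<not> doubling (left_democracy nrm e)"
proof (intro exI conjI allI impI)
  show "banach_space_on coord_scale (fac.comb_space :: (nat \<Rightarrow> 'k) set) fac.comb_norm"
    by (rule fac.banach_space_comb)
  show "normed_space_on.schauder_basis coord_scale (fac.comb_space :: (nat \<Rightarrow> 'k) set)
      fac.comb_norm unit_seq"
    by (rule fac.schauder_basis_unit_seq)
  show "fac.comb_norm (unit_seq j :: nat \<Rightarrow> 'k) = 1" for j
    by (rule fac.comb_norm_unit_seq)
  show "\<not> doubling (left_democracy fac.comb_norm (unit_seq :: nat \<Rightarrow> nat \<Rightarrow> 'k))"
    by (rule not_doubling_left_democracy)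
next
  fix a x l :: "nat \<Rightarrow> 'k"
  assume "normed_space_on.series_sums coord_scale fac.comb_space fac.comb_norm unit_seq a x
    \<and> (\<forall>j. norm (l j) \<le> 1)"
  then have x: "a = x" "x \<in> fac.comb_space" and l: "\<And>j. norm (l j) \<le> 1"
    by (auto simp: fac.series_sums_unit_seq_iff)
  have "norm (l j * a j) \<le> norm (x j)" for j
    using l[of j] by (simp add: x(1) norm_mult mult_left_le_one_le)
  from fac.comb_space_solid[OF x(2), of "\<lambda>j. l j * a j", OF this]
  show "normed_space_on.series_sums coord_scale fac.comb_space fac.comb_norm unit_seq
      (\<lambda>j. l j * a j) (\<lambda>j. l j * a j)" "fac.comb_norm (\<lambda>j. l j * a j) \<le> fac.comb_norm x"
    by (simp_all add: fac.series_sums_unit_seq_iff)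
qed

end
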